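(* Let $G$ be an infinite abelian group with no elements of order $2$. Then there exists a colouring $c:G\to\omega$ such that there are no $a,b\in G$ with $b\neq0$ for which $c$ is constant on $\{a,a+b,a+2b\}$. *)

theory Defs
  imports "HOL-Algebra.Algebra"
begin

end

(* By Zorn's lemma, take a maximal pair (H, c), where H is a subgroup closed under halving
   (x * x in H implies x in H) and c is a colouring of H without monochromatic progressions.
   If g is outside H, let H' consist of those x for which some x^(2^k) lies in the
   subgroup generated by H and g. Since G/H has no 2-torsion, the quotient H'/H is countable, so
   an element x of H' - H can be coloured by the pair consisting of its coset and the colour of
   its translate into H. Of three terms in progression, two are both inside or both outside H;
   if all have the same colour, this forces the common difference into H, hence the whole
   progression into a single coset of H, where translating it back into H gives a contradiction. *)
theory Submission
  imports Defs
begin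

section \<open>Subgroups whose quotient has no 2-torsion\<close>

text \<open>In an abelian group this says that the quotient by \<open>H\<close> has no element of
  order 2.\<close>

definition halving_closed :: "('a, 'm) monoid_scheme \<Rightarrow> 'a set \<Rightarrow> bool" where
  "halving_closed G H \<longleftrightarrow>
     subgroup H G \<and> (\<forall>x\<in>carrier G. x \<otimes>\<^bsub>G\<^esub> x \<in> H \<longrightarrow> x \<in> H)"

definition progression_free :: "('a, 'm) monoid_scheme \<Rightarrow> 'a set \<Rightarrow> ('a \<Rightarrow> 'c) \<Rightarrow> bool" where
  "progression_free G H c \<longleftrightarrow> (\<forall>a\<in>H. \<forall>b\<in>H.
     c a = c (a \<otimes>\<^bsub>G\<^esub> b) \<longrightarrow> c a = c (a \<otimes>\<^bsub>G\<^esub> (b \<otimes>\<^bsub>G\<^esub> b)) \<longrightarrow> b = \<one>\<^bsub>G\<^esub>)"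

text \<open>For a subgroup \<open>H\<close> of an abelian group, the condition puts
  \<open>x [^] (2 ^ k)\<close> into the subgroup generated by \<open>H\<close> and \<open>g\<close>;
  since \<open>n\<close> is an integer, its sign is immaterial. The explicit pair
  \<open>(k, n)\<close> is what later makes the cosets countable.\<close>

definition halving_span :: "('a, 'm) monoid_scheme \<Rightarrow> 'a set \<Rightarrow> 'a \<Rightarrow> 'a set" where
  "halving_span G H g = {x \<in> carrier G. \<exists>(k::nat) (n::int).
     x [^]\<^bsub>G\<^esub> (2 ^ k :: nat) \<otimes>\<^bsub>G\<^esub> g [^]\<^bsub>G\<^esub> n \<in> H}"

context comm_group
begin

lemma halving_closed_pow2:
  assumes "halving_closed G H" "x \<in> carrier G" "x [^] (2 ^ k :: nat) \<in> H"
  shows "x \<in> H"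
  using assms(3)
proof (induction k)
  case 0
  then show ?case using assms(2) by simp
next
  case (Suc k)
  have "x [^] (2 ^ Suc k :: nat) = x [^] (2 ^ k :: nat) \<otimes> x [^] (2 ^ k :: nat)"
    using assms(2) by (simp add: nat_pow_mult mult_2)
  then show ?case
    using Suc assms(1,2) unfolding halving_closed_def by (metis nat_pow_closed)
qed

section \<open>Adjoining one element and all its halves\<close>

lemma subgroup_halving_span:
  assumes H: "subgroup H G" and g: "g \<in> carrier G"
  shows "subgroup (halving_span G H g) G"
proof (rule subgroupI)
  interpret H: subgroup H G by (rule H)
  show "halving_span G H g \<subseteq> carrier G"
    by (auto simp: halving_span_def)
  have "\<one> [^] (2 ^ 0 :: nat) \<otimes> g [^] (0::int) \<in> H" by simp
  then show "halving_span G H g \<noteq> {}"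
    unfolding halving_span_def by blast
next
  interpret H: subgroup H G by (rule H)
  fix x assume "x \<in> halving_span G H g"
  then obtain k n where x: "x \<in> carrier G"
    and 1: "x [^] (2 ^ k :: nat) \<otimes> g [^] (n::int) \<in> H"
    by (auto simp: halving_span_def)
  have "inv (x [^] (2 ^ k :: nat) \<otimes> g [^] n) = inv x [^] (2 ^ k :: nat) \<otimes> g [^] (- n)"
    using x g by (simp add: inv_mult int_pow_neg nat_pow_inv)
  with 1 have "inv x [^] (2 ^ k :: nat) \<otimes> g [^] (- n) \<in> H"
    by (metis H.m_inv_closed)
  then show "inv x \<in> halving_span G H g"
    unfolding halving_span_def using x by blast
next
  interpret H: subgroup H G by (rule H)
  fix x y assume "x \<in> halving_span G H g" "y \<in> halving_span G H g"
  then obtain k n l m where x: "x \<in> carrier G" and y: "y \<in> carrier G"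
    and 1: "x [^] (2 ^ k :: nat) \<otimes> g [^] (n::int) \<in> H"
    and 2: "y [^] (2 ^ l :: nat) \<otimes> g [^] (m::int) \<in> H"
    by (auto simp: halving_span_def)
  have pow_closed: "u [^] (j::nat) \<in> H" if "u \<in> H" for u j
    using that by (induction j) auto
  have expand: "(u [^] i \<otimes> g [^] p) [^] j = u [^] (i * j) \<otimes> g [^] (p * int j)"
    if "u \<in> carrier G" for u and i j :: nat and p :: int
    using that g by (simp add: int_pow_distrib int_pow_pow flip: int_pow_int)
  \<comment> \<open>Raising each relation to the other's power of two brings both to the common
    exponent \<open>2 ^ (k + l)\<close>, after which they can be multiplied.\<close>
  have "(x [^] (2 ^ k :: nat) \<otimes> g [^] n) [^] (2 ^ l :: nat) \<otimes>
        (y [^] (2 ^ l :: nat) \<otimes> g [^] m) [^] (2 ^ k :: nat) \<in> H"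
    using 1 2 pow_closed by blast
  also have "(x [^] (2 ^ k :: nat) \<otimes> g [^] n) [^] (2 ^ l :: nat) \<otimes>
        (y [^] (2 ^ l :: nat) \<otimes> g [^] m) [^] (2 ^ k :: nat) =
      (x [^] (2 ^ (k + l) :: nat) \<otimes> y [^] (2 ^ (k + l) :: nat)) \<otimes>
        (g [^] (n * int (2 ^ l)) \<otimes> g [^] (m * int (2 ^ k)))"
    using x y g unfolding expand[OF x] expand[OF y]
    by (simp add: power_add mult.commute m_ac)
  also have "\<dots> = (x \<otimes> y) [^] (2 ^ (k + l) :: nat) \<otimes> g [^] (n * int (2 ^ l) + m * int (2 ^ k))"
    using x y g by (simp only: nat_pow_distrib int_pow_mult)
  finally show "x \<otimes> y \<in> halving_span G H g"
    unfolding halving_span_def using x y by blast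
qed

lemma halving_closed_span:
  assumes "subgroup H G" "g \<in> carrier G"
  shows "halving_closed G (halving_span G H g)"
  unfolding halving_closed_def
proof (intro conjI ballI impI subgroup_halving_span assms)
  fix x assume x: "x \<in> carrier G" and "x \<otimes> x \<in> halving_span G H g"
  then obtain k n where "(x \<otimes> x) [^] (2 ^ k :: nat) \<otimes> g [^] (n::int) \<in> H"
    by (auto simp: halving_span_def)
  moreover have "(x \<otimes> x) [^] (2 ^ k :: nat) = x [^] (2 ^ Suc k :: nat)"
    using x by (simp add: nat_pow_distrib nat_pow_mult mult_2)
  ultimately have "x [^] (2 ^ Suc k :: nat) \<otimes> g [^] n \<in> H" by simp
  then show "x \<in> halving_span G H g"
    unfolding halving_span_def using x by blast
qed

lemma subset_halving_span:
  assumes "subgroup H G"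
  shows "H \<subseteq> halving_span G H g"
proof
  fix x assume "x \<in> H"
  moreover from this have "x \<in> carrier G" by (rule subgroup.mem_carrier[OF assms])
  ultimately have "x \<in> carrier G" "x [^] (2 ^ 0 :: nat) \<otimes> g [^] (0::int) \<in> H" by auto
  then show "x \<in> halving_span G H g" unfolding halving_span_def by blast
qed

lemma mem_halving_span:
  assumes "subgroup H G" "g \<in> carrier G"
  shows "g \<in> halving_span G H g"
proof -
  have "g [^] (2 ^ 0 :: nat) \<otimes> g [^] (- 1 :: int) \<in> H"
    using assms by (simp add: int_pow_neg subgroup.one_closed)
  then show ?thesis unfolding halving_span_def using assms(2) by blast
qed

text \<open>Index \<open>x\<close> by a pair \<open>(k, n)\<close> witnessing its membership. If
  \<open>x\<close> and \<open>y\<close> share the pair, dividing the two relations cancels the power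
  of \<open>g\<close> and leaves \<open>(x \<otimes> inv y) [^] (2 ^ k)\<close> in \<open>H\<close>,
  so \<open>x \<otimes> inv y\<close> is in \<open>H\<close> by halving. An index thus determines a
  coset, while one coset may carry several indices.\<close>

lemma countable_halving_span_cosets:
  assumes H: "halving_closed G H" and g: "g \<in> carrier G"
  obtains idx :: "'a \<Rightarrow> nat" where
    "\<And>x y. x \<in> halving_span G H g \<Longrightarrow> y \<in> halving_span G H g \<Longrightarrow> idx x = idx y \<Longrightarrow> x \<otimes> inv y \<in> H"
proof -
  have sub: "subgroup H G" using H by (simp add: halving_closed_def)
  have "\<exists>k n. x [^] (2 ^ k :: nat) \<otimes> g [^] (n::int) \<in> H"
    if "x \<in> halving_span G H g" for x
    using that by (auto simp: halving_span_def)
  then obtain K N where KN: "\<And>x. x \<in> halving_span G H g \<Longrightarrow>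
      x [^] (2 ^ K x :: nat) \<otimes> g [^] (N x :: int) \<in> H"
    by metis
  define idx where "idx x = to_nat (K x :: nat, N x)" for x
  have "x \<otimes> inv y \<in> H"
    if x: "x \<in> halving_span G H g" and y: "y \<in> halving_span G H g" and eq: "idx x = idx y" for x y
  proof -
    have xy: "x \<in> carrier G" "y \<in> carrier G"
      using x y by (auto simp: halving_span_def)
    obtain k n where 1: "x [^] (2 ^ k :: nat) \<otimes> g [^] (n::int) \<in> H"
      and 2: "y [^] (2 ^ k :: nat) \<otimes> g [^] n \<in> H"
      using KN[OF x] KN[OF y] eq by (auto simp: idx_def)
    have "(x [^] (2 ^ k :: nat) \<otimes> g [^] n) \<otimes> inv (y [^] (2 ^ k :: nat) \<otimes> g [^] n) \<in> H"
      using 1 2 sub by (simp add: subgroup.m_closed subgroup.m_inv_closed)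
    also have "(x [^] (2 ^ k :: nat) \<otimes> g [^] n) \<otimes> inv (y [^] (2 ^ k :: nat) \<otimes> g [^] n)
        = x [^] (2 ^ k :: nat) \<otimes> inv (y [^] (2 ^ k :: nat)) \<otimes> (g [^] n \<otimes> inv (g [^] n))"
      using xy g by (simp only: inv_mult m_ac nat_pow_closed int_pow_closed inv_closed m_closed)
    also have "\<dots> = (x \<otimes> inv y) [^] (2 ^ k :: nat)"
      using xy g by (simp add: nat_pow_distrib nat_pow_inv)
    finally show ?thesis
      using halving_closed_pow2[OF H] xy by blast
  qed
  then show thesis using that by blast
qed

section \<open>Extending the colouring\<close>

lemma progression_free_extend:
  fixes c :: "'a \<Rightarrow> nat"
  assumes H: "halving_closed G H" and H': "halving_closed G H'" "H \<subseteq> H'"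
    and free: "progression_free G H c"
    and idx: "\<And>x y. x \<in> H' \<Longrightarrow> y \<in> H' \<Longrightarrow> (idx x :: nat) = idx y \<Longrightarrow> x \<otimes> inv y \<in> H"
  obtains c' :: "'a \<Rightarrow> nat" where "progression_free G H' c'" "\<And>x. x \<in> H \<Longrightarrow> c' x = c x"
proof -
  interpret H: subgroup H G using H by (simp add: halving_closed_def)
  interpret H': subgroup H' G using H' by (simp add: halving_closed_def)
  define rep where "rep i = (SOME r. r \<in> H' \<and> idx r = i)" for i
  have rep: "rep (idx x) \<in> H' \<and> idx (rep (idx x)) = idx x" if "x \<in> H'" for x
    unfolding rep_def by (rule someI[of _ x]) (use that in simp)
  define c' where "c' x = (if x \<in> H then c x
    else prod_encode (idx x, c (x \<otimes> inv (rep (idx x)))))" for x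
  \<comment> \<open>Colours inside and outside \<open>H\<close> may coincide, so only points on the
    same side are compared: inside, closure of \<open>H\<close> suffices; outside, the first
    component of the colour gives equal indices.\<close>
  have same: "u \<otimes> inv v \<in> H"
    if "u \<in> H'" "v \<in> H'" "c' u = c' v" "u \<in> H \<longleftrightarrow> v \<in> H" for u v
    using that idx by (auto simp: c'_def split: if_splits)
  have "b = \<one>" if a: "a \<in> H'" and b: "b \<in> H'"
    and ab: "c' a = c' (a \<otimes> b)" and abb: "c' a = c' (a \<otimes> (b \<otimes> b))" for a b
  proof -
    have carr: "a \<in> carrier G" "b \<in> carrier G" using a b by auto
    have mem: "a \<otimes> b \<in> H'" "a \<otimes> (b \<otimes> b) \<in> H'" using a b by auto
    have bH: "b \<in> H"
    proof -
      \<comment> \<open>Pigeonhole: three terms, two sides. Adjacent terms have quotient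
        \<open>b\<close>; the outer two have quotient \<open>b \<otimes> b\<close>, which is where
        \<open>H\<close> being closed under halving enters.\<close>
      consider "a \<in> H \<longleftrightarrow> a \<otimes> b \<in> H" | "a \<otimes> b \<in> H \<longleftrightarrow> a \<otimes> (b \<otimes> b) \<in> H"
        | "a \<in> H \<longleftrightarrow> a \<otimes> (b \<otimes> b) \<in> H" by blast
      then show ?thesis
      proof cases
        case 1
        have "(a \<otimes> b) \<otimes> inv a \<in> H" using same[of "a \<otimes> b" a] a mem ab 1 by simp
        moreover have "(a \<otimes> b) \<otimes> inv a = b" using carr by (simp add: m_comm[of a b] m_assoc)
        ultimately show ?thesis by simp
      next
        case 2
        have "(a \<otimes> (b \<otimes> b)) \<otimes> inv (a \<otimes> b) \<in> H"
          using same[of "a \<otimes> (b \<otimes> b)" "a \<otimes> b"] mem ab abb 2 by simp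
        moreover have "a \<otimes> (b \<otimes> b) = b \<otimes> (a \<otimes> b)" using carr by (simp add: m_ac)
        then have "(a \<otimes> (b \<otimes> b)) \<otimes> inv (a \<otimes> b) = b" using carr by (simp add: m_assoc[of b])
        ultimately show ?thesis by simp
      next
        case 3
        have "(a \<otimes> (b \<otimes> b)) \<otimes> inv a \<in> H"
          using same[of "a \<otimes> (b \<otimes> b)" a] a mem abb 3 by simp
        moreover have "(a \<otimes> (b \<otimes> b)) \<otimes> inv a = b \<otimes> b"
          using carr by (simp add: m_comm[of a "b \<otimes> b"] m_assoc)
        ultimately have "b \<otimes> b \<in> H" by simp
        then show ?thesis using H carr(2) unfolding halving_closed_def by blast
      qed
    qed
    have shift: "a \<otimes> h \<in> H \<longleftrightarrow> a \<in> H" if "h \<in> H" for h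
    proof
      assume "a \<otimes> h \<in> H"
      then have "(a \<otimes> h) \<otimes> inv h \<in> H" using that by blast
      then show "a \<in> H" using that carr by (simp add: m_assoc)
    qed (use that in blast)
    have bbH: "b \<otimes> b \<in> H" using bH by blast
    show ?thesis
    proof (cases "a \<in> H")
      case True
      then show ?thesis
        using free bH ab abb shift[OF bH] shift[OF bbH]
        by (auto simp: progression_free_def c'_def)
    next
      case False
      define r where "r = rep (idx a)"
      have r: "r \<in> carrier G" "a \<otimes> inv r \<in> H"
        using rep a idx unfolding r_def by auto
      \<comment> \<open>Lying in one coset would not give equal indices; equal colours do. Hence all
        three terms are translated by the same \<open>r\<close>, and the second components of their
        colours form a monochromatic progression in \<open>H\<close>.\<close>
      have ir: "idx (a \<otimes> b) = idx a" "idx (a \<otimes> (b \<otimes> b)) = idx a"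
        using ab abb False shift[OF bH] shift[OF bbH] by (auto simp: c'_def)
      have tr: "(a \<otimes> h) \<otimes> inv r = (a \<otimes> inv r) \<otimes> h" if "h \<in> carrier G" for h
        using carr r that by (simp add: m_ac)
      have "c (a \<otimes> inv r) = c ((a \<otimes> inv r) \<otimes> b)"
        "c (a \<otimes> inv r) = c ((a \<otimes> inv r) \<otimes> (b \<otimes> b))"
        using ab abb False shift[OF bH] shift[OF bbH] ir tr carr
        by (auto simp: c'_def simp flip: r_def)
      then show ?thesis
        using free bH r unfolding progression_free_def by blast
    qed
  qed
  then have "progression_free G H' c'" by (auto simp: progression_free_def)
  then show thesis using that by (simp add: c'_def)
qed

section \<open>Zorn's lemma\<close>

lemma exists_progression_free:
  assumes no2: "\<And>x. x \<in> carrier G \<Longrightarrow> x \<otimes> x = \<one> \<Longrightarrow> x = \<one>"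
  shows "\<exists>c :: 'a \<Rightarrow> nat. progression_free G (carrier G) c"
proof -
  \<comment> \<open>A pair \<open>(H, c)\<close> is encoded as the graph of \<open>c\<close> on
    \<open>H\<close>: inclusion then means extension of both subgroup and colouring, and values of
    \<open>c\<close> off \<open>H\<close> are forgotten.\<close>
  define gr :: "'a set \<Rightarrow> ('a \<Rightarrow> nat) \<Rightarrow> ('a \<times> nat) set" where "gr H c = (\<lambda>x. (x, c x)) ` H" for H c
  define A where "A = {gr H c | H c. halving_closed G H \<and> progression_free G H c}"
  \<comment> \<open>The trivial subgroup is closed under halving because \<open>G\<close> has no
    element of order 2.\<close>
  have "gr {\<one>} (\<lambda>_. 0) \<in> A"
    using no2 by (auto simp: A_def halving_closed_def progression_free_def triv_subgroup
        intro!: exI[of _ "{\<one>}"] exI[of _ "\<lambda>_. 0::nat"])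
  then have "A \<noteq> {}" by blast
  moreover have "\<Union>C \<in> A" if "C \<noteq> {}" and ch: "subset.chain A C" for C
  proof -
    have CA: "C \<subseteq> A" and lin: "\<And>F F'. F \<in> C \<Longrightarrow> F' \<in> C \<Longrightarrow> F \<subseteq> F' \<or> F' \<subseteq> F"
      using ch by (auto simp: subset_chain_def)
    define H where "H = fst ` (\<Union>C)"
    define c where "c x = (SOME k. (x, k) \<in> \<Union>C)" for x
    \<comment> \<open>By linearity of the chain both pairs lie in a single member, which is a
      graph.\<close>
    have sv: "k = l" if kl: "(x, k) \<in> \<Union>C" "(x, l) \<in> \<Union>C" for x k l
    proof -
      obtain F where "F \<in> C" "(x, k) \<in> F" "(x, l) \<in> F"
        using kl lin by blast
      then show ?thesis using CA by (auto simp: A_def gr_def)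
    qed
    have cI: "c x = k" if "(x, k) \<in> \<Union>C" for x k
      unfolding c_def using that sv by (blast intro: some_equality)
    have UC: "\<Union>C = gr H c"
      unfolding gr_def H_def using cI by (force simp: image_iff)
    \<comment> \<open>Each member is the graph of the limit colouring \<open>c\<close> restricted to
      its domain, so its properties can be restated for \<open>c\<close>.\<close>
    have member: "halving_closed G (fst ` F) \<and> progression_free G (fst ` F) c \<and> fst ` F \<subseteq> H"
      if F: "F \<in> C" for F
    proof -
      obtain K d where K: "F = gr K d" "halving_closed G K" "progression_free G K d"
        using F CA by (auto simp: A_def)
      have fst: "fst ` F = K" using K(1) by (force simp: gr_def)
      have cd: "c x = d x" if "x \<in> K" for x
        using K(1) that by (intro cI UnionI[OF F]) (auto simp: gr_def)
      have "progression_free G K c"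
        unfolding progression_free_def
      proof (intro ballI impI)
        fix a b assume ab: "a \<in> K" "b \<in> K" "c a = c (a \<otimes> b)" "c a = c (a \<otimes> (b \<otimes> b))"
        have "subgroup K G" using K(2) by (simp add: halving_closed_def)
        then have "a \<otimes> b \<in> K" "a \<otimes> (b \<otimes> b) \<in> K"
          using ab by (simp_all add: subgroup.m_closed)
        then have "d a = d (a \<otimes> b)" "d a = d (a \<otimes> (b \<otimes> b))"
          using ab cd by simp_all
        then show "b = \<one>" using K(3) ab by (simp add: progression_free_def)
      qed
      then show ?thesis using K(2) fst F by (auto simp: H_def)
    qed
    have one: "\<exists>F\<in>C. x \<in> fst ` F" if "x \<in> H" for x
      using that by (auto simp: H_def)
    \<comment> \<open>The closure conditions and progression-freeness involve at most two elements
      at a time, so they pass from the members to the union.\<close>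
    have two: "\<exists>F\<in>C. x \<in> fst ` F \<and> y \<in> fst ` F" if "x \<in> H" "y \<in> H" for x y
      using one[OF that(1)] one[OF that(2)] lin by (meson image_mono subsetD)
    have "subgroup H G"
    proof (rule subgroupI)
      show "H \<subseteq> carrier G"
        using one member by (meson halving_closed_def subgroup.mem_carrier subsetI)
      obtain F where F: "F \<in> C" using \<open>C \<noteq> {}\<close> by blast
      then show "H \<noteq> {}"
        using member by (metis halving_closed_def subgroup.one_closed subsetD empty_iff)
    next
      fix x assume "x \<in> H"
      then show "inv x \<in> H"
        using one member by (meson halving_closed_def subgroup.m_inv_closed subsetD)
    next
      fix x y assume "x \<in> H" "y \<in> H"
      then show "x \<otimes> y \<in> H"
        using two member by (meson halving_closed_def subgroup.m_closed subsetD)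
    qed
    moreover have "x \<in> H" if "x \<in> carrier G" "x \<otimes> x \<in> H" for x
      using one[OF that(2)] that(1) member by (meson halving_closed_def subsetD)
    moreover have "progression_free G H c"
      unfolding progression_free_def
    proof (intro ballI impI)
      fix a b assume ab: "a \<in> H" "b \<in> H" "c a = c (a \<otimes> b)" "c a = c (a \<otimes> (b \<otimes> b))"
      obtain F where "F \<in> C" "a \<in> fst ` F" "b \<in> fst ` F" using two ab by blast
      then show "b = \<one>" using member[of F] ab unfolding progression_free_def by blast
    qed
    ultimately show ?thesis
      unfolding UC A_def halving_closed_def by blast
  qed
  ultimately obtain M where M: "M \<in> A" "\<And>F. F \<in> A \<Longrightarrow> M \<subseteq> F \<Longrightarrow> F = M"
    using subset_Zorn_nonempty[of A] by metis
  then obtain H c where H: "M = gr H c" "halving_closed G H" "progression_free G H c"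
    by (auto simp: A_def)
  have sub: "subgroup H G" using H(2) by (simp add: halving_closed_def)
  have "g \<in> H" if g: "g \<in> carrier G" for g
  proof -
    let ?H' = "halving_span G H g"
    have H': "halving_closed G ?H'" "H \<subseteq> ?H'"
      using halving_closed_span[OF sub g] subset_halving_span[OF sub] by auto
    obtain c' where c': "progression_free G ?H' c'" "\<And>x. x \<in> H \<Longrightarrow> c' x = c x"
      using countable_halving_span_cosets[OF H(2) g] progression_free_extend[OF H(2) H' H(3)]
      by metis
    have "gr ?H' c' \<in> A" using H' c' by (auto simp: A_def)
    moreover have "M \<subseteq> gr ?H' c'" using H(1) H'(2) c'(2) by (auto simp: gr_def)
    \<comment> \<open>Equal graphs have equal domains, so the extension containing \<open>g\<close>
      is \<open>H\<close> itself.\<close>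
    ultimately have "gr ?H' c' = gr H c" using M(2) H(1) by blast
    then show ?thesis using mem_halving_span[OF sub g] by (auto simp: gr_def)
  qed
  then have "H = carrier G" using subgroup.subset[OF sub] by blast
  then show ?thesis using H(3) by blast
qed

text \<open>The order divides 2 and is not 2, so it is 1. This turns the hypothesis on
  \<open>ord\<close> into the form used for the trivial subgroup.\<close>

lemma eq_one_if_ord_neq_2:
  assumes "x \<in> carrier G" "ord x \<noteq> 2" "x \<otimes> x = \<one>"
  shows "x = \<one>"
proof -
  have "x [^] (2::nat) = \<one>" using assms by (simp add: numeral_2_eq_2)
  then have "ord x dvd 2" using assms(1) by (simp add: pow_eq_id)
  then have "ord x = 1" using assms(2) two_is_prime_nat prime_nat_iff by blast
  then show ?thesis using assms(1) ord_eq_1 by blast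
qed

end

theorem theorem5p2:
  fixes G (structure)
  assumes "comm_group G"
    and "infinite (carrier G)"
    and "\<And>x. x \<in> carrier G \<Longrightarrow> group.ord G x \<noteq> 2"
  shows "\<exists>c :: 'a \<Rightarrow> nat. \<not> (\<exists>a\<in>carrier G. \<exists>b\<in>carrier G. b \<noteq> \<one> \<and>
           (\<exists>k. \<forall>x\<in>{a, a \<otimes> b, a \<otimes> b [^] (2::nat)}. c x = k))"
proof -
  interpret comm_group G by fact
  obtain c :: "'a \<Rightarrow> nat" where c: "progression_free G (carrier G) c"
    using exists_progression_free eq_one_if_ord_neq_2 assms(3) by metis
  have "b [^] (2::nat) = b \<otimes> b" if "b \<in> carrier G" for b
    using that by (simp add: numeral_2_eq_2)
  then show ?thesis
    using c unfolding progression_free_def by (intro exI[of _ c]) auto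
qed

end
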